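(* Let $J:\mathbb{R}^N\to\mathbb{R}$ be a finite-valued convex function, let $x\in\mathbb{R}^N\setminus\{0\}$ and let $f_x\in\operatorname{ri}\partial J(x)$. Then the subdifferential of $J$ at $x$ is $$\partial J(x)=\Big\{\eta\in\mathbb{R}^N \;:\; P_{T_x}\eta=e_x \ \text{ and }\ J_{f_x}^{x,\circ}\big(P_{S_x}(\eta-f_x)\big)\le 1\Big\}.$$
   Context: For a finite-valued convex function $J$ on $\mathbb{R}^N$ and $x\in\mathbb{R}^N$: $\bar S_x$ is the affine hull of $\partial J(x)$; $e_x=\operatorname{argmin}_{e\in\bar S_x}\|e\|$ is the orthogonal projection of $0$ onto $\bar S_x$; $S_x=\bar S_x-e_x$ (a linear subspace) and $T_x=S_x^\perp$ (the model subspace). $P_V$ is the orthogonal projector onto a subspace $V$; $\operatorname{ri}$ is the relative interior. For a closed convex set $C$ containing $0$, its gauge is $\gamma_C(u)=\inf\{\lambda>0: u\in\lambda C\}$ (with $\inf\emptyset=+\infty$). For $f_x\in\operatorname{ri}\partial J(x)$, the subdifferential gauge is $J_{f_x}^{x,\circ}=\gamma_{\partial J(x)-f_x}$. *)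

theory Defs
  imports "HOL-Analysis.Analysis"
begin

definition subdifferential :: "('a::euclidean_space \<Rightarrow> real) \<Rightarrow> 'a \<Rightarrow> 'a set" where
  "subdifferential J x = {g. \<forall>y. J x + g \<bullet> (y - x) \<le> J y}"

definition subdiff_hull :: "('a::euclidean_space \<Rightarrow> real) \<Rightarrow> 'a \<Rightarrow> 'a set" where
  "subdiff_hull J x = affine hull (subdifferential J x)"

definition model_vector :: "('a::euclidean_space \<Rightarrow> real) \<Rightarrow> 'a \<Rightarrow> 'a" where
  "model_vector J x = (ARG_MIN norm e. e \<in> subdiff_hull J x)"

definition subdiff_direction :: "('a::euclidean_space \<Rightarrow> real) \<Rightarrow> 'a \<Rightarrow> 'a set" where
  "subdiff_direction J x = (\<lambda>v. v - model_vector J x) ` subdiff_hull J x"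

definition model_subspace :: "('a::euclidean_space \<Rightarrow> real) \<Rightarrow> 'a \<Rightarrow> 'a set" where
  "model_subspace J x = orthogonal_comp (subdiff_direction J x)"

definition orth_proj :: "'a::euclidean_space set \<Rightarrow> 'a \<Rightarrow> 'a" where
  "orth_proj V u = (THE p. p \<in> V \<and> u - p \<in> orthogonal_comp V)"

(* The name gauge is taken by the gauges of Henstock-Kurzweil integration.
   In ereal the infimum of the empty set is \<infinity>. *)
definition gauge_fun :: "'a::euclidean_space set \<Rightarrow> 'a \<Rightarrow> ereal" where
  "gauge_fun C u = Inf {ereal t | t. t > 0 \<and> u \<in> (\<lambda>c. t *\<^sub>R c) ` C}"

definition subdiff_gauge ::
    "('a::euclidean_space \<Rightarrow> real) \<Rightarrow> 'a \<Rightarrow> 'a \<Rightarrow> 'a \<Rightarrow> ereal" where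
  "subdiff_gauge J x f = gauge_fun ((\<lambda>g. g - f) ` subdifferential J x)"

lemma orth_proj_unique_exists:
  fixes V :: "'a::euclidean_space set"
  assumes "subspace V"
  shows "\<exists>!p. p \<in> V \<and> u - p \<in> orthogonal_comp V"
proof (rule ex_ex1I)
  obtain y z where y: "y \<in> span V" and z: "\<And>w. w \<in> span V \<Longrightarrow> orthogonal z w" and u: "u = y + z"
    using orthogonal_subspace_decomp_exists[of V u] by metis
  have "V = span V" using assms by (metis span_eq_iff)
  then show "\<exists>p. p \<in> V \<and> u - p \<in> orthogonal_comp V"
    using y z u by (intro exI[of _ y]) (auto simp: orthogonal_comp_def orthogonal_commute)
next
  fix p q
  assume p: "p \<in> V \<and> u - p \<in> orthogonal_comp V" and q: "q \<in> V \<and> u - q \<in> orthogonal_comp V"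
  have d: "p - q \<in> V" using p q assms by (simp add: subspace_diff)
  have "(p - q) \<bullet> (u - q) = 0" "(p - q) \<bullet> (u - p) = 0"
    using d p q by (auto simp: orthogonal_comp_def orthogonal_def)
  then have "(p - q) \<bullet> (p - q) = 0" by (simp add: inner_diff_right)
  then show "p = q" by simp
qed

end

theory Submission
  imports Defs
begin

text \<open>
  The two conditions on the right-hand side play different roles. The minimal-norm element \<open>e\<close> of
  the affine hull \<open>A\<close> of the subdifferential is orthogonal to the direction space \<open>S = A - e\<close>
  (lemma \<open>min_norm_affine_orthogonal\<close>), so it lies in \<open>T\<close>, the orthogonal complement of \<open>S\<close>. Hence
  the projection of \<open>\<eta>\<close> to \<open>T\<close> equals \<open>e\<close> exactly when \<open>\<eta> - e\<close> has no \<open>T\<close>-component, i.e. when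
  \<open>\<eta> \<in> A\<close> (lemma \<open>orth_proj_model_subspace_eq_iff\<close>): the first condition confines \<open>\<eta>\<close> to the affine
  hull.

  On that hull the projection in the second condition disappears: \<open>\<eta> - f\<close> is a difference of two
  points of \<open>A\<close> and so already belongs to \<open>S\<close>. What remains is that the gauge of
  \<open>\<partial>J(x) - f\<close> is at most \<open>1\<close> at \<open>\<eta> - f\<close>, and a closed convex set containing \<open>0\<close> is the unit
  sublevel set of its gauge (lemma \<open>gauge_fun_le_1_iff\<close>). The subdifferential is closed and convex
  because it is an intersection of closed half-spaces.
\<close>

text \<open>
  If the gauge is at most \<open>1\<close>, then for every \<open>t > 1\<close> some scale below \<open>t\<close> is admissible; as \<open>C\<close> is
  star-shaped about \<open>0\<close>, so is \<open>t\<close> itself, i.e. \<open>u /\<^sub>R t \<in> C\<close>. Closedness is what allows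
  \<open>t \<rightarrow> 1\<close>, since the infimum need not be attained.
\<close>
lemma gauge_fun_le_1_iff:
  fixes C :: "'a::euclidean_space set"
  assumes "closed C" "convex C" "0 \<in> C"
  shows "gauge_fun C u \<le> 1 \<longleftrightarrow> u \<in> C"
proof
  assume "u \<in> C"
  then have "u \<in> (\<lambda>c. 1 *\<^sub>R c) ` C" by simp
  then have "ereal 1 \<in> {ereal t | t. t > 0 \<and> u \<in> (\<lambda>c. t *\<^sub>R c) ` C}"
    by (intro CollectI exI[of _ 1]) simp
  then show "gauge_fun C u \<le> 1"
    unfolding gauge_fun_def by (simp add: Inf_lower one_ereal_def)
next
  assume le: "gauge_fun C u \<le> 1"
  have scaled: "u /\<^sub>R t \<in> C" if "t > 1" for t
  proof -
    have "gauge_fun C u < ereal t"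
      using le that by (simp add: le_less_trans one_ereal_def)
    then obtain s c where s: "s > 0" "s < t" and c: "c \<in> C" "u = s *\<^sub>R c"
      unfolding gauge_fun_def Inf_less_iff by auto
    have "(1 - s / t) *\<^sub>R 0 + (s / t) *\<^sub>R c \<in> C"
      using assms(2,3) s c(1) by (intro convexD) (auto simp: field_simps)
    then show ?thesis using c(2) by (simp add: field_simps)
  qed
  have "(\<lambda>n. 1 + inverse (real (Suc n))) \<longlonglongrightarrow> 1"
    by (rule LIMSEQ_inverse_real_of_nat_add)
  then have "(\<lambda>n. u /\<^sub>R (1 + inverse (real (Suc n)))) \<longlonglongrightarrow> u /\<^sub>R 1"
    by (intro tendsto_intros) auto
  then have "u /\<^sub>R 1 \<in> C"
    by (rule closed_sequentially[OF assms(1), rotated]) (rule scaled, simp)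
  then show "u \<in> C" by simp
qed

lemma orth_proj_eq_iff:
  fixes V :: "'a::euclidean_space set"
  assumes "subspace V"
  shows "orth_proj V u = p \<longleftrightarrow> p \<in> V \<and> u - p \<in> orthogonal_comp V"
proof
  show "p \<in> V \<and> u - p \<in> orthogonal_comp V" if "orth_proj V u = p"
    using theI'[OF orth_proj_unique_exists[OF assms, of u]] that by (simp add: orth_proj_def)
  show "orth_proj V u = p" if "p \<in> V \<and> u - p \<in> orthogonal_comp V"
    unfolding orth_proj_def
    by (rule the1_equality[OF orth_proj_unique_exists[OF assms] that])
qed

lemma orth_proj_eq_self:
  fixes V :: "'a::euclidean_space set"
  assumes "subspace V" "u \<in> V"
  shows "orth_proj V u = u"
  using assms by (simp add: orth_proj_eq_iff subspace_0 subspace_orthogonal_comp)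

text \<open>
  Minimality on a convex set only gives an obtuse-angle inequality. An affine set contains with
  \<open>y\<close> also its reflection \<open>2 *\<^sub>R e - y\<close> through \<open>e\<close>, and the
  inequalities for these two points have opposite signs.
\<close>
lemma min_norm_affine_orthogonal:
  fixes A :: "'a::euclidean_space set"
  assumes "affine A" "A \<noteq> {}"
  defines "e \<equiv> (ARG_MIN norm e. e \<in> A)"
  shows "e \<in> A" and "\<And>y. y \<in> A \<Longrightarrow> e \<bullet> (y - e) = 0"
proof -
  have A: "closed A" "convex A"
    using assms(1) by (simp_all add: affine_closed affine_imp_convex)
  obtain m where "m \<in> A" "\<And>z. z \<in> A \<Longrightarrow> dist 0 m \<le> dist 0 z"
    using distance_attains_inf[OF A(1) assms(2), of 0] by metis
  \<comment> \<open>\<open>ARG_MIN\<close> is meaningful only once a minimiser is known to exist.\<close>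
  then have "is_arg_min norm (\<lambda>z. z \<in> A) m"
    by (simp add: is_arg_min_linorder)
  then have "is_arg_min norm (\<lambda>z. z \<in> A) e"
    unfolding e_def arg_min_def by (rule someI)
  then have e: "e \<in> A" "\<And>z. z \<in> A \<Longrightarrow> norm e \<le> norm z"
    by (simp_all add: is_arg_min_linorder)
  have obtuse: "0 \<le> e \<bullet> (z - e)" if "z \<in> A" for z
    using any_closest_point_dot[OF A(2,1) e(1) that, of 0] e(2) by simp
  show "e \<in> A" by (fact e(1))
  fix y assume y: "y \<in> A"
  have "2 *\<^sub>R e + (-1) *\<^sub>R y \<in> A"
    using assms(1) e(1) y by (intro mem_affine) auto
  then have "0 \<le> e \<bullet> (2 *\<^sub>R e + (-1) *\<^sub>R y - e)" by (rule obtuse)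
  then have "e \<bullet> (y - e) \<le> 0"
    by (simp add: inner_diff_right inner_add_right)
  then show "e \<bullet> (y - e) = 0" using obtuse[OF y] by simp
qed

lemma subdifferential_eq_halfspaces:
  "subdifferential J x = (\<Inter>y. {g. (y - x) \<bullet> g \<le> J y - J x})"
  by (auto simp: subdifferential_def inner_commute algebra_simps)

lemma closed_subdifferential: "closed (subdifferential J x)"
  unfolding subdifferential_eq_halfspaces by (intro closed_INT ballI closed_halfspace_le)

lemma convex_subdifferential: "convex (subdifferential J x)"
  unfolding subdifferential_eq_halfspaces by (intro convex_INT convex_halfspace_le)

lemma
  assumes "subdifferential J x \<noteq> {}"
  shows model_vector_in_hull: "model_vector J x \<in> subdiff_hull J x"
    and subspace_subdiff_direction: "subspace (subdiff_direction J x)"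
    and model_vector_in_model_subspace: "model_vector J x \<in> model_subspace J x"
proof -
  let ?A = "subdiff_hull J x" and ?e = "model_vector J x"
  have A: "affine ?A" "?A \<noteq> {}"
    using assms by (simp_all add: subdiff_hull_def)
  note min_norm = min_norm_affine_orthogonal[OF A, folded model_vector_def]
  show e: "?e \<in> ?A" by (fact min_norm(1))
  show "subspace (subdiff_direction J x)"
    using affine_diffs_subspace_subtract[OF A(1) e]
    by (simp add: subdiff_direction_def)
  show "?e \<in> model_subspace J x"
    using min_norm(2)
    by (auto simp: model_subspace_def subdiff_direction_def orthogonal_comp_def orthogonal_def
        inner_commute)
qed

lemma diff_model_vector_in_direction_iff:
  "\<eta> - model_vector J x \<in> subdiff_direction J x \<longleftrightarrow> \<eta> \<in> subdiff_hull J x"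
  by (auto simp: subdiff_direction_def)

text \<open>
  In finite dimension the complement of \<open>T\<close> is \<open>S\<close> again, so, \<open>e\<close> being in \<open>T\<close>, the projection
  of \<open>\<eta>\<close> to \<open>T\<close> is \<open>e\<close> precisely when \<open>\<eta> - e \<in> S\<close>.
\<close>
lemma orth_proj_model_subspace_eq_iff:
  assumes "subdifferential J x \<noteq> {}"
  shows "orth_proj (model_subspace J x) \<eta> = model_vector J x \<longleftrightarrow> \<eta> \<in> subdiff_hull J x"
proof -
  have "orthogonal_comp (model_subspace J x) = subdiff_direction J x"
    unfolding model_subspace_def
    by (rule orthogonal_comp_self[OF subspace_subdiff_direction[OF assms]])
  moreover have "subspace (model_subspace J x)"
    by (simp add: model_subspace_def subspace_orthogonal_comp)
  ultimately show ?thesis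
    by (simp add: orth_proj_eq_iff model_vector_in_model_subspace[OF assms]
        diff_model_vector_in_direction_iff)
qed

lemma subdiff_gauge_le_1_iff:
  assumes "f \<in> subdifferential J x"
  shows "subdiff_gauge J x f (\<eta> - f) \<le> 1 \<longleftrightarrow> \<eta> \<in> subdifferential J x"
proof -
  let ?C = "(\<lambda>g. g - f) ` subdifferential J x"
  have "closed ?C" "convex ?C"
    by (simp_all add: closed_translation_subtract closed_subdifferential convex_subdifferential
        convex_translation_subtract)
  moreover have "0 \<in> ?C" using assms by auto
  ultimately have "subdiff_gauge J x f (\<eta> - f) \<le> 1 \<longleftrightarrow> \<eta> - f \<in> ?C"
    unfolding subdiff_gauge_def by (rule gauge_fun_le_1_iff)
  then show ?thesis by auto
qed

theorem theorem1:
  fixes J :: "real ^ 'n \<Rightarrow> real" and x f :: "real ^ 'n"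
  assumes "convex_on UNIV J"
    and "x \<noteq> 0"
    and "f \<in> rel_interior (subdifferential J x)"
  shows "subdifferential J x =
    {\<eta>. orth_proj (model_subspace J x) \<eta> = model_vector J x \<and>
        subdiff_gauge J x f (orth_proj (subdiff_direction J x) (\<eta> - f)) \<le> 1}"
proof -
  have f: "f \<in> subdifferential J x"
    using assms(3) rel_interior_subset by blast
  then have ne: "subdifferential J x \<noteq> {}" by blast
  have hull: "g \<in> subdiff_hull J x" if "g \<in> subdifferential J x" for g
    using that by (simp add: subdiff_hull_def hull_inc)
  have proj: "orth_proj (subdiff_direction J x) (\<eta> - f) = \<eta> - f"
    if "\<eta> \<in> subdiff_hull J x" for \<eta>
  proof -
    have "(\<eta> - model_vector J x) - (f - model_vector J x) \<in> subdiff_direction J x"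
      by (rule subspace_diff[OF subspace_subdiff_direction[OF ne]])
        (simp_all only: diff_model_vector_in_direction_iff that hull[OF f])
    then show ?thesis
      using subspace_subdiff_direction[OF ne] by (simp add: orth_proj_eq_self)
  qed
  show ?thesis
    using hull proj subdiff_gauge_le_1_iff[OF f]
    by (auto simp: orth_proj_model_subspace_eq_iff[OF ne])
qed

end
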